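(* Let $n\geq 1$ and let $$\det\nolimits_n=\sum_{\sigma\in\mathbb{S}_n}\operatorname{sgn}(\sigma)\,e_{\sigma(1)}\otimes e_{\sigma(2)}\otimes\cdots\otimes e_{\sigma(n)}\in\underbrace{\mathbb{C}^n\otimes\cdots\otimes\mathbb{C}^n}_n.$$ Then $\|\det_n\|_\star=n!$.
   Context: $\mathbb{S}_n$ is the symmetric group on $n$ letters, $\operatorname{sgn}(\sigma)\in\{1,-1\}$ is the sign of $\sigma$, and $e_1,\dots,e_n$ is the standard orthonormal basis of $\mathbb{C}^n$. For a tensor product $V=V^{(1)}\otimes\cdots\otimes V^{(d)}$ of finite dimensional Hilbert spaces (with the induced Hermitian form), a pure tensor is an element of the form $v^{(1)}\otimes\cdots\otimes v^{(d)}$ with $v^{(e)}\in V^{(e)}$. The nuclear norm $\|T\|_\star$ of $T\in V$ is the smallest possible value of $\sum_{i=1}^m\|v_i\|$ over all decompositions $T=\sum_{i=1}^m v_i$ ($m$ arbitrary) into pure tensors. *)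

theory Defs
  imports "HOL-Analysis.Analysis" "HOL-Combinatorics.Permutations"
begin

text \<open>
  \<open>complex^('d \<Rightarrow> 'n)\<close> is the coordinate model of the \<open>d\<close>-fold tensor power of
  \<open>\<complex>\<^sup>n = complex^'n\<close>, with \<open>d = CARD('d)\<close> and \<open>n = CARD('n)\<close>: the entry at the multi-index
  \<open>f\<close> is the coefficient of the tensor product of the basis vectors \<open>axis (f k) 1\<close>, \<open>k\<close> ranging
  over the factors. The library norm on this type is the one of the Hermitian form for which
  these basis tensors are orthonormal, i.e. of the induced Hermitian form
  (see \<open>tensor_hermitian_form\<close> and \<open>norm_eq_hermitian_form\<close> below).
\<close>

definition tensor :: "('d::finite \<Rightarrow> complex^'n::finite) \<Rightarrow> complex^('d \<Rightarrow> 'n)" where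
  "tensor v = (\<chi> f. \<Prod>k\<in>UNIV. v k $ f k)"

definition pure_tensor :: "complex^('d::finite \<Rightarrow> 'n::finite) \<Rightarrow> bool" where
  "pure_tensor T \<longleftrightarrow> (\<exists>v. T = tensor v)"

lemma tensor_hermitian_form:
  fixes v w :: "'d::finite \<Rightarrow> complex^'n::finite"
  shows "(\<Sum>f\<in>UNIV. tensor v $ f * cnj (tensor w $ f)) =
         (\<Prod>k\<in>UNIV. \<Sum>j\<in>UNIV. v k $ j * cnj (w k $ j))"
proof -
  have "(\<Prod>k\<in>UNIV. \<Sum>j\<in>UNIV. v k $ j * cnj (w k $ j)) =
        (\<Sum>f\<in>(\<Pi>\<^sub>E k\<in>UNIV. UNIV). \<Prod>k\<in>UNIV. v k $ f k * cnj (w k $ f k))"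
    by (rule prod_sum_PiE) auto
  then show ?thesis
    by (simp add: tensor_def prod.distrib)
qed

lemma norm_eq_hermitian_form:
  fixes T :: "complex^'i::finite"
  shows "complex_of_real ((norm T)\<^sup>2) = (\<Sum>f\<in>UNIV. T $ f * cnj (T $ f))"
  by (simp add: norm_vec_def L2_set_def sum_nonneg complex_norm_square del: of_real_power)

lemma tensor_axis:
  "tensor (\<lambda>k. axis (f k) 1) = (axis f 1 :: complex^('d::finite \<Rightarrow> 'n::finite))"
proof -
  have "(\<Prod>k\<in>UNIV. if g k = f k then 1 else 0 :: complex) = (if g = f then 1 else 0)"
    for g :: "'d \<Rightarrow> 'n"
    by (auto simp: fun_eq_iff)
  then show ?thesis
    by (simp add: tensor_def axis_def vec_eq_iff)
qed

text \<open>
  ``Smallest possible value'' is rendered literally by \<open>LEAST\<close>, so a statement about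
  the value of \<open>nuclear_norm T\<close> includes that the minimum is attained.
\<close>

definition nuclear_norm :: "complex^('d::finite \<Rightarrow> 'n::finite) \<Rightarrow> real" where
  "nuclear_norm T =
    (LEAST r. \<exists>m (v :: nat \<Rightarrow> complex^('d \<Rightarrow> 'n)).
       (\<forall>i<m. pure_tensor (v i)) \<and> T = (\<Sum>i<m. v i) \<and> r = (\<Sum>i<m. norm (v i)))"

text \<open>Here the tensor factors and the basis vectors are both indexed by \<open>'n\<close>.\<close>

definition det_tensor :: "complex^('n::finite \<Rightarrow> 'n)" where
  "det_tensor =
    (\<Sum>\<sigma> | \<sigma> permutes UNIV. of_int (sign \<sigma>) *\<^sub>R tensor (\<lambda>k. axis (\<sigma> k) 1))"

end

theory Submission
  imports Defs
begin

text \<open>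
  The determinant tensor is a sum of \<open>n!\<close> pure tensors of norm one. Conversely, pairing with
  it sends \<open>v\<^sub>1 \<otimes> \<dots> \<otimes> v\<^sub>n\<close> to the determinant of the matrix with rows \<open>v\<^sub>i\<close>, which Hadamard's
  inequality bounds by the norm of that pure tensor, and sends the determinant tensor itself
  to \<open>n!\<close>; so no decomposition has total norm below \<open>n!\<close>.

  Hadamard's inequality is obtained by compactness: a matrix with unit rows that maximizes
  \<open>|det|\<close> has orthogonal rows, because otherwise subtracting from one row its projection
  onto another one keeps the determinant but shortens the row.
\<close>

lemma det_cnj: "det (\<chi> i j. cnj (A $ i $ j)) = cnj (det (A :: complex^'n^'n))"
  by (simp add: det_def)

lemma continuous_on_det:
  "continuous_on S (det :: 'a::{comm_ring_1, real_normed_algebra_1}^'n^'n \<Rightarrow> 'a)"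
  unfolding det_def by (intro continuous_intros)

text \<open>Provides the maximizer of \<open>norm (det A)\<close>. The norm of a matrix is at most
  the sum of its row norms, hence bounded here, and the condition on the rows is closed.\<close>

lemma compact_unit_rows: "compact {A :: 'a::euclidean_space^'m^'n. \<forall>i. norm (A $ i) = 1}"
  unfolding compact_eq_bounded_closed
proof
  have "norm A \<le> real CARD('n)" if "\<forall>i. norm (A $ i) = 1" for A :: "'a^'m^'n"
    using L2_set_le_sum[of UNIV "\<lambda>i. norm (A $ i)"] that by (simp add: norm_vec_def)
  then show "bounded {A :: 'a^'m^'n. \<forall>i. norm (A $ i) = 1}"
    unfolding bounded_iff by blast
  show "closed {A :: 'a^'m^'n. \<forall>i. norm (A $ i) = 1}"
    by (intro closed_Collect_all closed_Collect_eq continuous_intros)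
qed

lemma norm_vector_smult: "norm (c *s (x :: complex^'n)) = norm c * norm x"
  by (simp add: norm_vec_def norm_mult L2_set_right_distrib)

text \<open>Pythagoras: as \<open>y\<close> is a unit vector, \<open>c *s y\<close> is the
  orthogonal projection of \<open>x\<close> onto its span and has norm
  \<open>norm c\<close>.\<close>

lemma norm_minus_projection:
  fixes x y :: "complex^'n"
  assumes "norm y = 1"
  defines "c \<equiv> \<Sum>k\<in>UNIV. x $ k * cnj (y $ k)"
  shows "(norm (x - c *s y))\<^sup>2 = (norm x)\<^sup>2 - (norm c)\<^sup>2"
proof -
  have cnj_c: "cnj c = (\<Sum>k\<in>UNIV. y $ k * cnj (x $ k))"
    by (simp add: c_def mult.commute)
  have y1: "(\<Sum>k\<in>UNIV. y $ k * cnj (y $ k)) = 1"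
    using norm_eq_hermitian_form[of y] assms by simp
  have "complex_of_real ((norm (x - c *s y))\<^sup>2) =
      (\<Sum>k\<in>UNIV. x $ k * cnj (x $ k) - c * (y $ k * cnj (x $ k))
         - cnj c * (x $ k * cnj (y $ k)) + c * cnj c * (y $ k * cnj (y $ k)))"
    unfolding norm_eq_hermitian_form by (intro sum.cong) (auto simp: algebra_simps)
  also have "\<dots> = (\<Sum>k\<in>UNIV. x $ k * cnj (x $ k)) - c * cnj c - cnj c * c + c * cnj c * 1"
    unfolding sum.distrib sum_subtractf sum_distrib_left[symmetric] y1 cnj_c[symmetric]
      c_def[symmetric] ..
  also have "\<dots> = complex_of_real ((norm x)\<^sup>2 - (norm c)\<^sup>2)"
    using complex_norm_square[of c] norm_eq_hermitian_form[of x] by simp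
  finally show ?thesis
    using of_real_eq_iff by blast
qed

text \<open>The hypothesis says that \<open>A\<close> times its conjugate transpose is the identity;
  taking determinants gives \<open>(norm (det A))\<^sup>2 = 1\<close>.\<close>

lemma norm_det_orthonormal_rows:
  fixes A :: "complex^'n^'n"
  assumes "\<And>i j. (\<Sum>k\<in>UNIV. A $ i $ k * cnj (A $ j $ k)) = (if i = j then 1 else 0)"
  shows "norm (det A) = 1"
proof -
  have "A ** transpose (\<chi> i j. cnj (A $ i $ j)) = mat 1"
    by (simp add: matrix_matrix_mult_def transpose_def mat_def vec_eq_iff assms)
  then have "det A * cnj (det A) = 1"
    by (metis det_I det_cnj det_mul det_transpose)
  then have "(norm (det A))\<^sup>2 = 1"
    by (metis complex_norm_square of_real_eq_1_iff)
  then show ?thesis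
    by (simp add: power2_eq_1_iff) (smt (verit) norm_ge_zero)
qed

lemma norm_det_unit_rows_le_1:
  fixes A :: "complex^'n^'n"
  assumes "\<And>i. norm (A $ i) = 1"
  shows "norm (det A) \<le> 1"
proof -
  let ?S = "{A :: complex^'n^'n. \<forall>i. norm (A $ i) = 1}"
  have mat_1: "mat 1 \<in> ?S"
    by (auto simp: norm_vec_def L2_set_def mat_def if_distrib if_distribR cong: if_cong)
  obtain B where B: "B \<in> ?S" and max: "\<And>C. C \<in> ?S \<Longrightarrow> norm (det C) \<le> norm (det B)"
    using continuous_attains_sup[OF compact_unit_rows _ continuous_on_norm[OF continuous_on_det]]
      mat_1 by blast
  \<comment> \<open>The identity matrix is a competitor. Hence \<open>det B\<close> is nonzero,
    which later excludes \<open>b = 0\<close> and allows cancelling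
    \<open>norm (det B)\<close>.\<close>
  have det_B: "norm (det B) \<ge> 1"
    using max[OF mat_1] by simp
  have "(\<Sum>k\<in>UNIV. B $ i $ k * cnj (B $ j $ k)) = 0" if "i \<noteq> j" for i j
  proof (rule ccontr)
    define c where "c = (\<Sum>k\<in>UNIV. B $ i $ k * cnj (B $ j $ k))"
    define b where "b = B $ i - c *s B $ j"
    assume "(\<Sum>k\<in>UNIV. B $ i $ k * cnj (B $ j $ k)) \<noteq> 0"
    then have "norm c > 0"
      by (simp add: c_def)
    moreover have "(norm b)\<^sup>2 = 1 - (norm c)\<^sup>2"
      using norm_minus_projection[of "B $ j" "B $ i"] B by (simp add: b_def c_def)
    ultimately have "(norm b)\<^sup>2 < 1"
      by simp
    then have b_less: "norm b < 1"
      by (simp add: power_less_one_iff)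
    have det_b: "det (\<chi> k. if k = i then b else B $ k) = det B"
      using det_row_operation[OF that, of B "- c"]
      by (simp add: b_def row_def cong: if_cong)
    have "b \<noteq> 0"
    proof
      assume "b = 0"
      then have "row i (\<chi> k. if k = i then b else B $ k) = 0"
        by (simp add: row_def vec_eq_iff)
      then show False
        using det_zero_row(1) det_b det_B by force
    qed
    \<comment> \<open>Rescaling the shortened row to unit length returns to \<open>?S\<close> but
      multiplies the determinant by \<open>s\<close>, with \<open>norm s > 1\<close>, against
      maximality.\<close>
    define s where "s = complex_of_real (1 / norm b)"
    let ?C = "\<chi> k. if k = i then s *s b else B $ k"
    have "?C \<in> ?S"
      using B \<open>b \<noteq> 0\<close> by (auto simp: norm_vector_smult s_def norm_divide)
    then have "norm (det ?C) \<le> norm (det B)"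
      by (rule max)
    moreover have "det ?C = s * det B"
      using det_row_mul[of i s "\<lambda>_. b" "\<lambda>k. B $ k"] det_b by simp
    ultimately have "norm s * norm (det B) \<le> 1 * norm (det B)"
      by (simp add: norm_mult)
    then have "norm s \<le> 1"
      using det_B by (simp only: mult_le_cancel_right)
    with b_less \<open>b \<noteq> 0\<close> show False
      by (simp add: s_def norm_divide)
  qed
  moreover have "(\<Sum>k\<in>UNIV. B $ i $ k * cnj (B $ i $ k)) = 1" for i
    using norm_eq_hermitian_form[of "B $ i"] B by simp
  ultimately have "norm (det B) = 1"
    by (intro norm_det_orthonormal_rows) auto
  with max[of A] assms show ?thesis
    by simp
qed

text \<open>A zero row makes the determinant vanish. Otherwise, dividing each row by its norm
  reduces to unit rows, and multilinearity restores the product of the norms.\<close>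

theorem hadamard_inequality:
  fixes A :: "complex^'n^'n"
  shows "norm (det A) \<le> (\<Prod>i\<in>UNIV. norm (A $ i))"
proof (cases "\<exists>i. A $ i = 0")
  case True
  then obtain i where "row i A = 0"
    by (auto simp: row_def vec_eq_iff)
  then show ?thesis
    by (simp add: det_zero_row(1) prod_nonneg)
next
  case False
  define U where "U = (\<chi> i. complex_of_real (1 / norm (A $ i)) *s A $ i)"
  have "norm (U $ i) = 1" for i
    using False by (simp add: U_def norm_vector_smult norm_divide)
  then have "norm (det U) \<le> 1"
    by (rule norm_det_unit_rows_le_1)
  have "A = (\<chi> i. complex_of_real (norm (A $ i)) *s U $ i)"
    using False by (simp add: U_def vec_eq_iff)
  then have "det A = (\<Prod>i\<in>UNIV. complex_of_real (norm (A $ i))) * det U"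
    using det_rows_mul[of "\<lambda>i. complex_of_real (norm (A $ i))" "\<lambda>i. U $ i"] by simp
  then have "norm (det A) = (\<Prod>i\<in>UNIV. norm (A $ i)) * norm (det U)"
    by (simp add: norm_mult flip: of_real_prod) (simp add: abs_prod)
  also have "\<dots> \<le> (\<Prod>i\<in>UNIV. norm (A $ i))"
    using \<open>norm (det U) \<le> 1\<close> by (simp add: mult_left_le prod_nonneg)
  finally show ?thesis .
qed

lemma norm_axis: "norm (axis i x) = norm x"
  by (simp add: norm_vec_def L2_set_def axis_def if_distrib if_distribR cong: if_cong)

text \<open>The Hermitian form of two pure tensors factorizes; this is the diagonal case.\<close>

lemma norm_tensor: "norm (tensor v) = (\<Prod>k\<in>UNIV. norm (v k))"
proof -
  have "complex_of_real ((norm (tensor v))\<^sup>2) = (\<Prod>k\<in>UNIV. complex_of_real ((norm (v k))\<^sup>2))"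
    by (simp only: norm_eq_hermitian_form tensor_hermitian_form)
  also have "\<dots> = complex_of_real ((\<Prod>k\<in>UNIV. norm (v k))\<^sup>2)"
    by (simp add: prod_power_distrib)
  finally show ?thesis
    by (metis norm_ge_zero of_real_eq_iff power2_eq_iff_nonneg prod_nonneg)
qed

lemma pure_tensor_scaleR:
  assumes "pure_tensor T"
  shows "pure_tensor (c *\<^sub>R T)"
proof -
  from assms obtain v where T: "T = tensor v"
    by (auto simp: pure_tensor_def)
  \<comment> \<open>Types are nonempty, so there is a factor \<open>a\<close> that can absorb the
    scalar.\<close>
  fix a :: 'a
  let ?w = "\<lambda>k. if k = a then c *\<^sub>R v k else v k"
  have "(\<Prod>k\<in>UNIV. ?w k $ f k) = c *\<^sub>R (\<Prod>k\<in>UNIV. v k $ f k)" for f :: "'a \<Rightarrow> 'b"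
    by (simp add: prod.remove[of UNIV a])
  then have "c *\<^sub>R T = tensor ?w"
    by (simp add: T tensor_def vec_eq_iff)
  then show ?thesis
    by (auto simp: pure_tensor_def)
qed

text \<open>The Hermitian pairing of \<open>T\<close> with \<open>det_tensor\<close>: the entries of
  the latter are real, so no conjugation appears, and they vanish off the permutations.\<close>

definition det_pairing :: "complex^('n::finite \<Rightarrow> 'n) \<Rightarrow> complex" where
  "det_pairing T = (\<Sum>\<sigma> | \<sigma> permutes UNIV. of_int (sign \<sigma>) * T $ \<sigma>)"

lemma det_pairing_sum: "det_pairing (\<Sum>i\<in>I. v i) = (\<Sum>i\<in>I. det_pairing (v i))"
  unfolding det_pairing_def by (simp add: sum_distrib_left) (rule sum.swap)

lemma norm_det_pairing_le:
  assumes "pure_tensor T"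
  shows "norm (det_pairing T) \<le> norm T"
proof -
  from assms obtain v where T: "T = tensor v"
    by (auto simp: pure_tensor_def)
  have "det_pairing T = det (\<chi> i. v i)"
    by (simp add: T det_pairing_def det_def tensor_def)
  with hadamard_inequality[of "\<chi> i. v i"] show ?thesis
    by (simp add: T norm_tensor)
qed

lemma det_tensor_nth:
  assumes "\<sigma> permutes UNIV"
  shows "det_tensor $ \<sigma> = of_int (sign \<sigma>)"
proof -
  have "det_tensor $ \<sigma> =
      (\<Sum>\<tau> | \<tau> permutes UNIV. if \<tau> = \<sigma> then of_int (sign \<sigma>) else 0 :: complex)"
    \<comment> \<open>Each summand is a signed basis vector \<open>axis \<tau> 1\<close>, so only
      \<open>\<tau> = \<sigma>\<close> contributes to the entry at \<open>\<sigma>\<close>.\<close>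
    unfolding det_tensor_def tensor_axis sum_component
    by (intro sum.cong) (auto simp: axis_def sign_def)
  then show ?thesis
    using assms by (simp add: finite_permutations)
qed

lemma card_permutes_UNIV: "card {\<sigma> :: 'n::finite \<Rightarrow> 'n. \<sigma> permutes UNIV} = fact CARD('n)"
  by (simp add: card_permutations)

lemma det_pairing_det_tensor:
  "det_pairing (det_tensor :: complex^('n::finite \<Rightarrow> 'n)) = fact CARD('n)"
proof -
  have "det_pairing (det_tensor :: complex^('n \<Rightarrow> 'n)) =
      (\<Sum>\<sigma> :: 'n \<Rightarrow> 'n | \<sigma> permutes UNIV. 1)"
    unfolding det_pairing_def
    by (intro sum.cong) (auto simp: det_tensor_nth sign_idempotent simp flip: of_int_mult)
  then show ?thesis
    by (simp add: card_permutes_UNIV)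
qed

theorem theorem1p15:
  "nuclear_norm (det_tensor :: complex^('n::finite \<Rightarrow> 'n)) = fact CARD('n)"
  unfolding nuclear_norm_def
proof (rule Least_equality)
  let ?P = "{\<sigma> :: 'n \<Rightarrow> 'n. \<sigma> permutes UNIV}"
  define t :: "('n \<Rightarrow> 'n) \<Rightarrow> complex^('n \<Rightarrow> 'n)"
    where "t \<sigma> = of_int (sign \<sigma>) *\<^sub>R tensor (\<lambda>k. axis (\<sigma> k) 1)" for \<sigma>
  have pure: "pure_tensor (t \<sigma>)" for \<sigma>
    unfolding t_def by (intro pure_tensor_scaleR) (auto simp: pure_tensor_def)
  have norm_t: "norm (t \<sigma>) = 1" for \<sigma>
    by (simp add: t_def norm_tensor norm_axis sign_def)
  \<comment> \<open>Decompositions are indexed by initial segments of \<open>nat\<close>, so the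
    permutations are enumerated.\<close>
  obtain h :: "nat \<Rightarrow> _" where h: "bij_betw h {..<fact CARD('n)} ?P"
    using ex_bij_betw_nat_finite[of ?P]
    unfolding card_permutes_UNIV atLeast0LessThan by (auto simp: finite_permutations)
  have "det_tensor = (\<Sum>i<fact CARD('n). t (h i))"
    unfolding det_tensor_def t_def[symmetric] by (rule sum.reindex_bij_betw[OF h, symmetric])
  then show "\<exists>m (v :: nat \<Rightarrow> complex^('n \<Rightarrow> 'n)). (\<forall>i<m. pure_tensor (v i)) \<and>
      det_tensor = (\<Sum>i<m. v i) \<and> fact CARD('n) = (\<Sum>i<m. norm (v i))"
    by (intro exI[of _ "fact CARD('n)"] exI[of _ "\<lambda>i. t (h i)"]) (simp add: pure norm_t)
next
  fix r
  assume "\<exists>m (v :: nat \<Rightarrow> complex^('n \<Rightarrow> 'n)). (\<forall>i<m. pure_tensor (v i)) \<and>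
      det_tensor = (\<Sum>i<m. v i) \<and> r = (\<Sum>i<m. norm (v i))"
  then obtain m and v :: "nat \<Rightarrow> complex^('n \<Rightarrow> 'n)" where pure: "\<forall>i<m. pure_tensor (v i)"
    and decomp: "det_tensor = (\<Sum>i<m. v i)" and r: "r = (\<Sum>i<m. norm (v i))"
    by blast
  \<comment> \<open>Duality: a linear functional bounded by the norm on pure tensors bounds the cost
    of every decomposition from below.\<close>
  have "fact CARD('n) = norm (det_pairing (det_tensor :: complex^('n \<Rightarrow> 'n)))"
    by (simp add: det_pairing_det_tensor)
  also have "\<dots> \<le> (\<Sum>i<m. norm (det_pairing (v i)))"
    unfolding decomp det_pairing_sum by (rule norm_sum)
  also have "\<dots> \<le> r"
    unfolding r using pure by (intro sum_mono norm_det_pairing_le) auto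
  finally show "fact CARD('n) \<le> r" .
qed

end
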